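(* Let $f:\mathbb{R}^{d_x}\to\mathbb{R}$ be convex and $L_f$-smooth for some $L_f>0$, and let $g:\mathbb{R}^{d_x}\to\mathbb{R}\cup\{+\infty\}$ be proper, closed and $\mu_g$-strongly convex for some $\mu_g\ge 0$. Let $(x^\star,z^\star)$ satisfy $0\in\partial g(x^\star)+\nabla f(z^\star)$ and $z^\star=x^\star$. Let $\eta_x,\eta_z>0$ satisfy $L_f\eta_x\eta_z\le 1$. Let $(x^k,z^k)_{k\ge 0}$ be generated, from arbitrary $x^0,z^0\in\mathbb{R}^{d_x}$, either by APGD or by APGE with stepsizes $\eta_x,\eta_z$, and define $$\Phi_k=\frac{1}{2\eta_x}\|x^k-x^\star\|^2+\frac1{\eta_z}D_f(z^k;z^\star)+s\,\langle\nabla f(z^k)-\nabla f(z^\star),x^k-x^\star\rangle,$$ where $s=-1$ for APGD and $s=+1$ for APGE. Then for every $k\ge0$, $$\Phi_k\le\theta^k\Phi_0,\qquad \theta=\max\left\{\frac{1}{1+\mu_g\eta_x},\ \frac{2}{2+\eta_z}\right\}.$$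
   Context: A proper closed function $\phi$ is $\mu$-strongly convex ($\mu\ge0$; $\mu=0$ means convex) if $\phi(x)\ge\phi(y)+\langle p,x-y\rangle+\frac{\mu}{2}\|x-y\|^2$ for all $x,y\in\mathrm{dom}(\phi)$ and all $p\in\partial\phi(y)$. A differentiable $\phi$ is $L$-smooth if $\nabla\phi$ is $L$-Lipschitz. $D_f(x;y)=f(x)-f(y)-\langle\nabla f(y),x-y\rangle$. $\mathrm{prox}_F(v)=\arg\min_w\{F(w)+\frac12\|w-v\|^2\}$. APGD (for $k=0,1,2,\dots$): $x^{k+1}=\mathrm{prox}_{\eta_x g}(x^k-\eta_x\nabla f(z^k))$, then $z^{k+1}=\frac{1}{1+\eta_z}z^k+\frac{\eta_z}{1+\eta_z}(2x^{k+1}-x^k)$. APGE (for $k=0,1,2,\dots$): $z^{k+1}=\frac{1}{1+\eta_z}z^k+\frac{\eta_z}{1+\eta_z}x^k$, then $x^{k+1}=\mathrm{prox}_{\eta_x g}\big(x^k-\eta_x(2\nabla f(z^{k+1})-\nabla f(z^k))\big)$. *)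

theory Defs
  imports "HOL-Analysis.Analysis"
begin

definition proper_fun :: "('a \<Rightarrow> ereal) \<Rightarrow> bool" where
  "proper_fun g \<longleftrightarrow> (\<forall>x. g x \<noteq> -\<infinity>) \<and> (\<exists>x. g x \<noteq> \<infinity>)"

definition effective_domain :: "('a \<Rightarrow> ereal) \<Rightarrow> 'a set" where
  "effective_domain g = {x. g x < \<infinity>}"

definition ereal_epigraph :: "('a \<Rightarrow> ereal) \<Rightarrow> ('a \<times> real) set" where
  "ereal_epigraph g = {(x, r). g x \<le> ereal r}"

definition closed_fun :: "('a::topological_space \<Rightarrow> ereal) \<Rightarrow> bool" where
  "closed_fun g \<longleftrightarrow> closed (ereal_epigraph g)"

definition convex_fun :: "('a::real_vector \<Rightarrow> ereal) \<Rightarrow> bool" where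
  "convex_fun g \<longleftrightarrow> convex (ereal_epigraph g)"

definition subdifferential :: "('a::real_inner \<Rightarrow> ereal) \<Rightarrow> 'a \<Rightarrow> 'a set" where
  "subdifferential g y =
     {p. y \<in> effective_domain g \<and> (\<forall>x. g x \<ge> g y + ereal (p \<bullet> (x - y)))}"

text \<open>Convexity is a separate conjunct: the inequality speaks only about points with a
  subgradient, and it holds trivially for \<open>\<mu> = 0\<close> (even for nonconvex functions).\<close>

definition strongly_convex_fun :: "real \<Rightarrow> ('a::real_inner \<Rightarrow> ereal) \<Rightarrow> bool" where
  "strongly_convex_fun \<mu> g \<longleftrightarrow> convex_fun g \<and>
     (\<forall>x\<in>effective_domain g. \<forall>y\<in>effective_domain g. \<forall>p\<in>subdifferential g y.
        g x \<ge> g y + ereal (p \<bullet> (x - y) + \<mu> / 2 * (norm (x - y))\<^sup>2))"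

definition grad :: "('a::real_inner \<Rightarrow> real) \<Rightarrow> 'a \<Rightarrow> 'a" where
  "grad f x = (THE D. GDERIV f x :> D)"

definition smooth_fun :: "real \<Rightarrow> ('a::real_inner \<Rightarrow> real) \<Rightarrow> bool" where
  "smooth_fun L f \<longleftrightarrow> (\<forall>x. f differentiable (at x)) \<and> L-lipschitz_on UNIV (grad f)"

definition bregman :: "('a::real_inner \<Rightarrow> real) \<Rightarrow> 'a \<Rightarrow> 'a \<Rightarrow> real" where
  "bregman f x y = f x - f y - grad f y \<bullet> (x - y)"

text \<open>For proper, closed, convex \<open>F\<close> the minimizer exists and is unique.\<close>

definition prox :: "('a::real_normed_vector \<Rightarrow> ereal) \<Rightarrow> 'a \<Rightarrow> 'a" where
  "prox F v = arg_min (\<lambda>w. F w + ereal (1 / 2 * (norm (w - v))\<^sup>2)) (\<lambda>_. True)"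

definition APGD ::
  "('a::real_inner \<Rightarrow> real) \<Rightarrow> ('a \<Rightarrow> ereal) \<Rightarrow> real \<Rightarrow> real \<Rightarrow> (nat \<Rightarrow> 'a) \<Rightarrow> (nat \<Rightarrow> 'a) \<Rightarrow> bool" where
  "APGD f g \<eta>x \<eta>z x z \<longleftrightarrow> (\<forall>k.
     x (Suc k) = prox (\<lambda>w. ereal \<eta>x * g w) (x k - \<eta>x *\<^sub>R grad f (z k)) \<and>
     z (Suc k) = (1 / (1 + \<eta>z)) *\<^sub>R z k + (\<eta>z / (1 + \<eta>z)) *\<^sub>R (2 *\<^sub>R x (Suc k) - x k))"

definition APGE ::
  "('a::real_inner \<Rightarrow> real) \<Rightarrow> ('a \<Rightarrow> ereal) \<Rightarrow> real \<Rightarrow> real \<Rightarrow> (nat \<Rightarrow> 'a) \<Rightarrow> (nat \<Rightarrow> 'a) \<Rightarrow> bool" where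
  "APGE f g \<eta>x \<eta>z x z \<longleftrightarrow> (\<forall>k.
     z (Suc k) = (1 / (1 + \<eta>z)) *\<^sub>R z k + (\<eta>z / (1 + \<eta>z)) *\<^sub>R x k \<and>
     x (Suc k) = prox (\<lambda>w. ereal \<eta>x * g w)
                   (x k - \<eta>x *\<^sub>R (2 *\<^sub>R grad f (z (Suc k)) - grad f (z k))))"

definition Lyapunov ::
  "('a::real_inner \<Rightarrow> real) \<Rightarrow> real \<Rightarrow> real \<Rightarrow> real \<Rightarrow> 'a \<Rightarrow> 'a \<Rightarrow> 'a \<Rightarrow> 'a \<Rightarrow> real" where
  "Lyapunov f \<eta>x \<eta>z s xs zs x z =
     1 / (2 * \<eta>x) * (norm (x - xs))\<^sup>2 + 1 / \<eta>z * bregman f z zs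
       + s * ((grad f z - grad f zs) \<bullet> (x - xs))"

end

theory Submission
  imports Defs
begin

text \<open>Write \<open>u = x - x\<^sup>*\<close>, \<open>w = z - z\<^sup>*\<close>, \<open>a = \<nabla>f(z) - \<nabla>f(z\<^sup>*)\<close>, with primes for the next iterate. Strong
  monotonicity of the subdifferential of \<open>g\<close> at the proximal point and the cocoercivity form of
  smoothness give \<open>\<Phi>' + \<mu> \<parallel>u'\<parallel>\<^sup>2 + a' \<bullet> w' \<le> \<Phi>\<close> for both methods. By cocoercivity at \<open>z\<^sup>*\<close> and
  Young's inequality the surplus \<open>\<mu> \<parallel>u'\<parallel>\<^sup>2 + a' \<bullet> w'\<close> is at least \<open>\<delta> \<Phi>'\<close> with
  \<open>\<delta> = min (\<mu> \<eta>\<^sub>x) (\<eta>\<^sub>z / 2)\<close>, and \<open>\<theta> = 1 / (1 + \<delta>)\<close>.\<close>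

section \<open>Gradients of smooth convex functions\<close>

text \<open>The definite description in \<open>grad\<close> denotes: the Riesz representative
  \<open>adjoint f' 1\<close> of the derivative is a gradient, and uniqueness of derivatives
  excludes any other.\<close>

lemma GDERIV_grad:
  fixes f :: "'a::euclidean_space \<Rightarrow> real"
  assumes "f differentiable (at x)"
  shows "GDERIV f x :> grad f x"
proof -
  obtain f' where f': "(f has_derivative f') (at x)"
    using assms by (auto simp: differentiable_def)
  have "f' = (\<lambda>h. h \<bullet> adjoint f' 1)"
    using adjoint_works[OF has_derivative_linear[OF f'], of _ 1] by auto
  with f' have G: "GDERIV f x :> adjoint f' 1"
    by (simp add: gderiv_def)
  have "D = adjoint f' 1" if "GDERIV f x :> D" for D
  proof -
    have "(\<lambda>h. h \<bullet> D) = (\<lambda>h. h \<bullet> adjoint f' 1)"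
      using has_derivative_unique that G unfolding gderiv_def by blast
    then show ?thesis
      by (metis vector_eq_ldot)
  qed
  with G show ?thesis
    unfolding grad_def by (rule theI[where P = "\<lambda>D. GDERIV f x :> D"])
qed

lemma DERIV_along_line:
  fixes f :: "'a::real_inner \<Rightarrow> real"
  assumes "GDERIV f (x + t *\<^sub>R d) :> D"
  shows "((\<lambda>t. f (x + t *\<^sub>R d)) has_field_derivative (D \<bullet> d)) (at t)"
proof -
  have "((\<lambda>t. x + t *\<^sub>R d) has_derivative (\<lambda>h. h *\<^sub>R d)) (at t)"
    by (auto intro!: derivative_eq_intros)
  from has_derivative_compose[OF this, of f "\<lambda>h. h \<bullet> D"] assms
  have "((\<lambda>t. f (x + t *\<^sub>R d)) has_derivative (\<lambda>h. (h *\<^sub>R d) \<bullet> D)) (at t)"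
    by (simp add: gderiv_def)
  then show ?thesis
    by (simp add: has_field_derivative_def inner_commute mult_commute_abs)
qed

text \<open>Restriction to the line through \<open>x\<close> and \<open>y\<close> reduces this to
  the tangent inequality for convex functions of one real variable.\<close>

lemma convex_on_above_tangent_plane:
  fixes f :: "'a::real_inner \<Rightarrow> real"
  assumes "convex_on UNIV f" and "GDERIV f x :> D"
  shows "f x + D \<bullet> (y - x) \<le> f y"
proof -
  let ?h = "\<lambda>t::real. f (x + t *\<^sub>R (y - x))"
  have "convex_on UNIV ?h"
  proof (rule convex_onI)
    fix t a b :: real
    assume "0 < t" "t < 1"
    have "x + ((1 - t) *\<^sub>R a + t *\<^sub>R b) *\<^sub>R (y - x)
        = (1 - t) *\<^sub>R (x + a *\<^sub>R (y - x)) + t *\<^sub>R (x + b *\<^sub>R (y - x))"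
      by (simp add: algebra_simps)
    then show "?h ((1 - t) *\<^sub>R a + t *\<^sub>R b) \<le> (1 - t) * ?h a + t * ?h b"
      using convex_onD[OF assms(1), of t "x + a *\<^sub>R (y - x)" "x + b *\<^sub>R (y - x)"] \<open>0 < t\<close> \<open>t < 1\<close>
      by simp
  qed auto
  moreover have "(?h has_field_derivative (D \<bullet> (y - x))) (at 0)"
    by (rule DERIV_along_line) (use assms(2) in simp)
  ultimately have "?h 1 - ?h 0 \<ge> (D \<bullet> (y - x)) * (1 - 0)"
    by (intro convex_on_imp_above_tangent[where A = UNIV]) auto
  then show ?thesis by simp
qed

lemma descent_lemma:
  fixes f :: "'a::euclidean_space \<Rightarrow> real"
  assumes "smooth_fun L f"
  shows "f y \<le> f x + grad f x \<bullet> (y - x) + L / 2 * (norm (y - x))\<^sup>2"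
proof -
  define d where "d = y - x"
  \<comment> \<open>\<open>h\<close> is \<open>f\<close> along the segment minus the nonconstant
    terms of its quadratic model at \<open>x\<close>. The Lipschitz gradient makes its derivative
    nonpositive for \<open>t \<ge> 0\<close>, and \<open>h 1 \<le> h 0\<close> is the claim.\<close>
  define h where "h t = f (x + t *\<^sub>R d) - t * (grad f x \<bullet> d) - L / 2 * (norm d)\<^sup>2 * t\<^sup>2" for t :: real
  have G: "GDERIV f u :> grad f u" for u
    using assms by (auto simp: smooth_fun_def intro: GDERIV_grad)
  have "\<exists>D. (h has_real_derivative D) (at t) \<and> D \<le> 0" if "0 \<le> t" for t
  proof (intro exI conjI)
    show "(h has_real_derivative
        (grad f (x + t *\<^sub>R d) \<bullet> d - grad f x \<bullet> d - L * (norm d)\<^sup>2 * t)) (at t)"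
      unfolding h_def
    proof (intro DERIV_diff)
      show "((\<lambda>t. f (x + t *\<^sub>R d)) has_real_derivative grad f (x + t *\<^sub>R d) \<bullet> d) (at t)"
        by (rule DERIV_along_line[OF G])
    qed (auto intro!: derivative_eq_intros)
    have "dist (grad f (x + t *\<^sub>R d)) (grad f x) \<le> L * dist (x + t *\<^sub>R d) x"
      using assms lipschitz_onD[of L UNIV "grad f"] by (simp add: smooth_fun_def)
    then have lip: "norm (grad f (x + t *\<^sub>R d) - grad f x) \<le> L * (t * norm d)"
      using that by (simp add: dist_norm)
    have "(grad f (x + t *\<^sub>R d) - grad f x) \<bullet> d
        \<le> norm (grad f (x + t *\<^sub>R d) - grad f x) * norm d"
      by (rule norm_cauchy_schwarz)
    also have "\<dots> \<le> L * (t * norm d) * norm d"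
      using lip by (rule mult_right_mono) simp
    finally show "grad f (x + t *\<^sub>R d) \<bullet> d - grad f x \<bullet> d - L * (norm d)\<^sup>2 * t \<le> 0"
      by (simp add: inner_diff_left power2_eq_square mult_ac)
  qed
  then have "h 1 \<le> h 0"
    by (intro DERIV_nonpos_imp_nonincreasing[OF zero_le_one]) blast
  then show ?thesis
    by (simp add: h_def d_def)
qed

text \<open>Compare the tangent plane at \<open>x\<close> with the quadratic upper model at \<open>y\<close>, both evaluated at
  the gradient step \<open>y - (\<nabla>f(y) - \<nabla>f(x)) / L\<close>.\<close>

lemma smooth_convex_lower_bound:
  fixes f :: "'a::euclidean_space \<Rightarrow> real"
  assumes "L > 0" and "convex_on UNIV f" and "smooth_fun L f"
  shows "f x + grad f x \<bullet> (y - x) + (norm (grad f y - grad f x))\<^sup>2 / (2 * L) \<le> f y"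
proof -
  define a where "a = grad f y - grad f x"
  define y' where "y' = y - (1 / L) *\<^sub>R a"
  have "GDERIV f x :> grad f x"
    using assms(3) by (auto simp: smooth_fun_def intro: GDERIV_grad)
  from convex_on_above_tangent_plane[OF assms(2) this, of y']
  have low: "f x + grad f x \<bullet> (y - x) - (grad f x \<bullet> a) / L \<le> f y'"
    by (simp add: y'_def inner_diff_right)
  have "(norm (y' - y))\<^sup>2 = (norm a)\<^sup>2 / L\<^sup>2"
    by (simp add: y'_def power_divide)
  with descent_lemma[OF assms(3), of y' y]
  have up: "f y' \<le> f y - (grad f y \<bullet> a) / L + L / 2 * ((norm a)\<^sup>2 / L\<^sup>2)"
    by (simp add: y'_def)
  have "grad f y \<bullet> a = grad f x \<bullet> a + (norm a)\<^sup>2"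
    by (simp add: a_def power2_norm_eq_inner inner_diff_left inner_diff_right)
  with low up \<open>L > 0\<close> have "f x + grad f x \<bullet> (y - x) + (norm a)\<^sup>2 / (2 * L) \<le> f y"
    by (simp add: field_simps power2_eq_square)
  then show ?thesis by (simp add: a_def)
qed

lemma bregman_self [simp]: "bregman f x x = 0"
  by (simp add: bregman_def)

text \<open>Subtracting the tangent at \<open>c\<close> only shifts gradients by a constant. With
  \<open>y\<close> the old iterate this drives the decrease; with \<open>y = c\<close> the right
  side vanishes and cocoercivity at \<open>c\<close> results.\<close>

lemma bregman_lower_bound:
  fixes f :: "'a::euclidean_space \<Rightarrow> real"
  assumes "L > 0" and "convex_on UNIV f" and "smooth_fun L f"
  shows "bregman f x c + (grad f x - grad f c) \<bullet> (y - x)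
      + (norm (grad f y - grad f x))\<^sup>2 / (2 * L) \<le> bregman f y c"
  using smooth_convex_lower_bound[OF assms, of x y]
  by (simp add: bregman_def inner_diff_left inner_diff_right)

lemma bregman_nonneg:
  fixes f :: "'a::euclidean_space \<Rightarrow> real"
  assumes "convex_on UNIV f" and "smooth_fun L f"
  shows "0 \<le> bregman f x c"
  using convex_on_above_tangent_plane[OF assms(1) GDERIV_grad, of c x] assms(2)
  by (simp add: bregman_def smooth_fun_def)

section \<open>Subgradients and the proximal map\<close>

text \<open>Adding the two strong convexity inequalities cancels the function values, which are
  finite on the effective domain.\<close>

lemma subdifferential_strongly_monotone:
  assumes "proper_fun g" and "strongly_convex_fun \<mu> g"
    and "p \<in> subdifferential g x" and "q \<in> subdifferential g y"
  shows "\<mu> * (norm (x - y))\<^sup>2 \<le> (p - q) \<bullet> (x - y)"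
proof -
  have dom: "x \<in> effective_domain g" "y \<in> effective_domain g"
    using assms(3,4) by (auto simp: subdifferential_def)
  then obtain gx gy where g: "g x = ereal gx" "g y = ereal gy"
    using assms(1) by (cases "g x"; cases "g y") (auto simp: effective_domain_def proper_fun_def)
  have "g y \<ge> g x + ereal (p \<bullet> (y - x) + \<mu> / 2 * (norm (y - x))\<^sup>2)"
    "g x \<ge> g y + ereal (q \<bullet> (x - y) + \<mu> / 2 * (norm (x - y))\<^sup>2)"
    using assms(2-4) dom by (auto simp: strongly_convex_fun_def)
  then show ?thesis
    by (simp add: g inner_diff_left inner_diff_right norm_minus_commute[of y x])
qed

lemma ereal_prox_objective:
  "g w = ereal r \<Longrightarrow>
    ereal \<eta> * g w + ereal (1 / 2 * (norm (w - v))\<^sup>2) = ereal (\<eta> * r + (norm (w - v))\<^sup>2 / 2)"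
  by simp

text \<open>Completing the square in the affine minorant given by \<open>p\<close> bounds the sublevel set of the
  objective in the epigraph, on which the linear-quadratic objective is continuous.\<close>

lemma prox_minimizer_exists:
  fixes g :: "'a::euclidean_space \<Rightarrow> ereal"
  assumes "proper_fun g" and "closed_fun g" and "p \<in> subdifferential g y" and "\<eta> > 0"
  obtains m where "\<And>w. ereal \<eta> * g m + ereal (1 / 2 * (norm (m - v))\<^sup>2)
      \<le> ereal \<eta> * g w + ereal (1 / 2 * (norm (w - v))\<^sup>2)"
proof -
  define J where "J = (\<lambda>(w, r). \<eta> * r + (norm (w - v))\<^sup>2 / 2 :: real)"
  obtain gy where gy: "g y = ereal gy"
    using assms(1,3) by (cases "g y") (auto simp: subdifferential_def effective_domain_def proper_fun_def)
  define C where "C = J (y, gy)"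
  define S where "S = ereal_epigraph g \<inter> {e. J e \<le> C}"
  have contJ: "continuous_on A J" for A
    unfolding J_def case_prod_unfold by (intro continuous_intros) auto
  have minor: "gy + p \<bullet> (w - y) \<le> r" if "(w, r) \<in> ereal_epigraph g" for w r
  proof -
    have "ereal (gy + p \<bullet> (w - y)) \<le> g w"
      using assms(3) by (auto simp: subdifferential_def gy)
    also have "\<dots> \<le> ereal r"
      using that by (simp add: ereal_epigraph_def)
    finally show ?thesis by simp
  qed
  \<comment> \<open>Inserting the affine minorant into \<open>J \<le> C\<close> and completing the
    square about \<open>v - \<eta> *\<^sub>R p\<close> gives the radius \<open>R\<close>. On that
    ball the minorant is at least \<open>- B\<close>.\<close>
  define R where "R = sqrt (2 * (C - \<eta> * gy - \<eta> * (p \<bullet> (v - y)) + \<eta>\<^sup>2 * (norm p)\<^sup>2 / 2))"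
  define B where "B = \<bar>gy\<bar> + norm p * (R + norm (v - \<eta> *\<^sub>R p - y))"
  have S_sub: "S \<subseteq> cball (v - \<eta> *\<^sub>R p) R \<times> {- B..C / \<eta>}"
  proof clarify
    fix w r
    assume "(w, r) \<in> S"
    then have epi: "(w, r) \<in> ereal_epigraph g" and le: "\<eta> * r + (norm (w - v))\<^sup>2 / 2 \<le> C"
      by (auto simp: S_def J_def)
    have "\<eta> * (gy + p \<bullet> (w - y)) \<le> \<eta> * r"
      using minor[OF epi] assms(4) by simp
    moreover have "(norm (w - (v - \<eta> *\<^sub>R p)))\<^sup>2
        = (norm (w - v))\<^sup>2 + 2 * \<eta> * (p \<bullet> (w - v)) + \<eta>\<^sup>2 * (norm p)\<^sup>2"
      unfolding power2_norm_eq_inner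
        by (simp add: inner_diff_left inner_diff_right inner_add_left inner_add_right inner_commute
            power2_eq_square algebra_simps)
    ultimately have "(norm (w - (v - \<eta> *\<^sub>R p)))\<^sup>2
        \<le> 2 * (C - \<eta> * gy - \<eta> * (p \<bullet> (v - y)) + \<eta>\<^sup>2 * (norm p)\<^sup>2 / 2)"
      using le by (simp add: inner_diff_right algebra_simps)
    then have w: "norm (w - (v - \<eta> *\<^sub>R p)) \<le> R"
      unfolding R_def by (rule real_le_rsqrt)
    have "\<bar>p \<bullet> (w - y)\<bar> \<le> norm p * norm (w - y)"
      by (rule Cauchy_Schwarz_ineq2)
    also have "\<dots> \<le> norm p * (R + norm (v - \<eta> *\<^sub>R p - y))"
      using norm_triangle_ineq[of "w - (v - \<eta> *\<^sub>R p)" "v - \<eta> *\<^sub>R p - y"] w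
      by (intro mult_left_mono) auto
    finally have "- B \<le> r"
      using minor[OF epi] by (simp add: B_def)
    moreover have "r \<le> C / \<eta>"
      using le assms(4) zero_le_power2[of "norm (w - v)"]
      unfolding pos_le_divide_eq[OF assms(4)] mult.commute[of r] by linarith
    ultimately show "w \<in> cball (v - \<eta> *\<^sub>R p) R \<and> r \<in> {- B..C / \<eta>}"
      using w by (simp add: dist_norm norm_minus_commute)
  qed
  have "bounded S"
    by (rule bounded_subset[OF _ S_sub]) (intro bounded_Times bounded_cball bounded_closed_interval)
  moreover have "closed S"
    unfolding S_def using assms(2)
    by (intro closed_Int closed_Collect_le contJ) (auto simp: closed_fun_def)
  ultimately have "compact S"
    by (simp add: compact_eq_bounded_closed)
  moreover have yS: "(y, gy) \<in> S"
    by (simp add: S_def C_def ereal_epigraph_def gy)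
  ultimately obtain m t where mS: "(m, t) \<in> S" and min: "\<And>e. e \<in> S \<Longrightarrow> J (m, t) \<le> J e"
    using continuous_attains_inf[OF _ _ contJ, of S] by force
  \<comment> \<open>Off \<open>S\<close>, \<open>J\<close> exceeds \<open>C\<close>, its value at
    \<open>(y, gy)\<close>, so the minimum over \<open>S\<close> is one over the whole
    epigraph.\<close>
  have min': "J (m, t) \<le> J e" if "e \<in> ereal_epigraph g" for e
    using min[of e] min[OF yS] that by (cases "J e \<le> C") (auto simp: S_def C_def)
  show thesis
  proof
    fix w
    obtain gm where gm: "g m = ereal gm" "gm \<le> t"
      using mS assms(1) by (cases "g m") (auto simp: S_def ereal_epigraph_def proper_fun_def)
    show "ereal \<eta> * g m + ereal (1 / 2 * (norm (m - v))\<^sup>2)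
      \<le> ereal \<eta> * g w + ereal (1 / 2 * (norm (w - v))\<^sup>2)"
    proof (cases "g w")
      case (real r)
      have "\<eta> * gm \<le> \<eta> * t"
        using gm assms(4) by simp
      with min'[of "(w, r)"] show ?thesis
        unfolding ereal_prox_objective[of g, OF gm(1)] ereal_prox_objective[of g, OF real]
        by (simp add: J_def ereal_epigraph_def real)
    next
      case PInf
      then show ?thesis using assms(4) by simp
    next
      case MInf
      then show ?thesis using assms(1) by (simp add: proper_fun_def)
    qed
  qed
qed

text \<open>Fermat's rule by hand: compare \<open>m\<close> with points on the segment towards
  \<open>x\<close>, divide by \<open>t\<close>, and let \<open>t\<close> tend to 0 so that the
  quadratic remainder disappears.\<close>

lemma prox_minimizer_subgradient:
  fixes g :: "'a::real_inner \<Rightarrow> ereal"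
  assumes "proper_fun g" and "convex_fun g" and "\<eta> > 0"
    and min: "\<And>w. ereal \<eta> * g m + ereal (1 / 2 * (norm (m - v))\<^sup>2)
      \<le> ereal \<eta> * g w + ereal (1 / 2 * (norm (w - v))\<^sup>2)"
  shows "(1 / \<eta>) *\<^sub>R (v - m) \<in> subdifferential g m"
proof -
  obtain w0 r0 where w0: "g w0 = ereal r0"
    using assms(1) unfolding proper_fun_def by (metis ereal_cases)
  obtain gm where gm: "g m = ereal gm"
    using min[of w0] assms(1,3) w0 by (cases "g m") (auto simp: proper_fun_def)
  have "g x \<ge> g m + ereal ((1 / \<eta>) *\<^sub>R (v - m) \<bullet> (x - m))" for x
  proof (cases "g x")
    case (real gx)
    let ?d = "x - m"
    have seg: "(v - m) \<bullet> ?d - t * (norm ?d)\<^sup>2 / 2 \<le> \<eta> * (gx - gm)" if "0 < t" "t < 1" for t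
    proof -
      let ?y = "m + t *\<^sub>R ?d"
      have "(1 - t) *\<^sub>R (m, gm) + t *\<^sub>R (x, gx) \<in> ereal_epigraph g"
        using assms(2) that gm real unfolding convex_fun_def
        by (intro convexD) (auto simp: ereal_epigraph_def)
      then have gy: "g ?y \<le> ereal ((1 - t) * gm + t * gx)"
        by (simp add: ereal_epigraph_def algebra_simps)
      then obtain r where r: "g ?y = ereal r" "r \<le> (1 - t) * gm + t * gx"
        using assms(1) by (cases "g ?y") (auto simp: proper_fun_def)
      have "\<eta> * gm + (norm (m - v))\<^sup>2 / 2 \<le> \<eta> * r + (norm (?y - v))\<^sup>2 / 2"
        using min[of ?y] unfolding ereal_prox_objective[of g, OF gm] ereal_prox_objective[of g, OF r(1)]
        by simp
      moreover have "\<eta> * r \<le> \<eta> * ((1 - t) * gm + t * gx)"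
        using r assms(3) by simp
      moreover have "(norm (?y - v))\<^sup>2
          = (norm (m - v))\<^sup>2 - 2 * t * ((v - m) \<bullet> ?d) + t\<^sup>2 * (norm ?d)\<^sup>2"
        unfolding power2_norm_eq_inner
        by (simp add: inner_diff_left inner_diff_right inner_add_left inner_add_right inner_commute
            power2_eq_square algebra_simps)
      ultimately have "t * ((v - m) \<bullet> ?d - t * (norm ?d)\<^sup>2 / 2) \<le> t * (\<eta> * (gx - gm))"
        by (simp add: algebra_simps power2_eq_square)
      then show ?thesis using that by simp
    qed
    have "((\<lambda>t. (v - m) \<bullet> ?d - t * (norm ?d)\<^sup>2 / 2) \<longlongrightarrow> (v - m) \<bullet> ?d - 0 * (norm ?d)\<^sup>2 / 2) (at_right 0)"
      by (intro tendsto_intros) auto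
    moreover have "\<forall>\<^sub>F t in at_right (0::real). (v - m) \<bullet> ?d - t * (norm ?d)\<^sup>2 / 2 \<le> \<eta> * (gx - gm)"
      using eventually_at_right_real[OF zero_less_one] by eventually_elim (auto intro: seg)
    ultimately have "(v - m) \<bullet> ?d \<le> \<eta> * (gx - gm)"
      using tendsto_upperbound by fastforce
    then have "gm + (v - m) \<bullet> ?d / \<eta> \<le> gx"
      using assms(3) by (simp add: field_simps)
    then show ?thesis by (simp add: gm real)
  next
    case MInf
    then show ?thesis using assms(1) by (simp add: proper_fun_def)
  qed simp
  then show ?thesis
    by (simp add: subdifferential_def effective_domain_def gm)
qed

text \<open>\<open>arg_min\<close> is a choice operator, so a minimizer must exist before anything
  is known about \<open>prox\<close>. The subgradient \<open>p\<close> supplies the affine minorant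
  for this.\<close>

lemma prox_subgradient:
  fixes g :: "'a::euclidean_space \<Rightarrow> ereal" and v :: 'a
  assumes "proper_fun g" and "closed_fun g" and "convex_fun g"
    and "p \<in> subdifferential g y" and "\<eta> > 0"
  defines "m \<equiv> prox (\<lambda>w. ereal \<eta> * g w) v"
  shows "(1 / \<eta>) *\<^sub>R (v - m) \<in> subdifferential g m"
proof (rule prox_minimizer_subgradient[OF assms(1,3,5)])
  let ?J = "\<lambda>w. ereal \<eta> * g w + ereal (1 / 2 * (norm (w - v))\<^sup>2)"
  obtain n where "\<And>w. ?J n \<le> ?J w"
    using prox_minimizer_exists[OF assms(1,2,4,5)] by blast
  then have "is_arg_min ?J (\<lambda>_. True) n"
    by (simp add: is_arg_min_linorder)
  then have "is_arg_min ?J (\<lambda>_. True) m"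
    unfolding m_def prox_def arg_min_def by (rule someI)
  then show "?J m \<le> ?J w" for w
    by (simp add: is_arg_min_linorder)
qed

section \<open>The Lyapunov function\<close>

lemma Young_inner:
  fixes a b :: "'a::real_inner"
  assumes "\<eta> > 0"
  shows "\<bar>a \<bullet> b\<bar> \<le> \<eta> / 2 * (norm a)\<^sup>2 + (norm b)\<^sup>2 / (2 * \<eta>)"
proof -
  have "\<bar>a \<bullet> b\<bar> \<le> norm a * norm b"
    by (rule Cauchy_Schwarz_ineq2)
  also have "\<dots> \<le> \<eta> / 2 * (norm a)\<^sup>2 + (norm b)\<^sup>2 / (2 * \<eta>)"
    using assms zero_le_power2[of "\<eta> * norm a - norm b"]
    by (simp add: field_simps power2_eq_square)
  finally show ?thesis .
qed

lemma Lyapunov_contraction: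
  fixes u a w :: "'a::real_inner"
  assumes "L > 0" "\<eta> > 0" "\<eta>z > 0" "L * \<eta> * \<eta>z \<le> 1" "\<mu> \<ge> 0" "\<bar>s\<bar> = 1" "F \<ge> 0"
    and cocoercive: "F + (norm a)\<^sup>2 / (2 * L) \<le> a \<bullet> w"
    and \<Phi>: "\<Phi> = 1 / (2 * \<eta>) * (norm u)\<^sup>2 + 1 / \<eta>z * F + s * (a \<bullet> u)"
    and decrease: "\<Phi> + \<mu> * (norm u)\<^sup>2 + a \<bullet> w \<le> \<Psi>"
  shows "\<Phi> \<le> max (1 / (1 + \<mu> * \<eta>)) (2 / (2 + \<eta>z)) * \<Psi>"
proof -
  \<comment> \<open>Young's inequality bounds \<open>\<Phi>\<close> by three terms. The cap
    \<open>\<mu> * \<eta>\<close> lets \<open>\<mu> * (norm u)\<^sup>2\<close> pay for the first;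
    the cap \<open>\<eta>z / 2\<close> charges the other two to at most half of what
    \<open>cocoercive\<close> supplies.\<close>
  define \<delta> where "\<delta> = min (\<mu> * \<eta>) (\<eta>z / 2)"
  have \<delta>: "0 \<le> \<delta>" "\<delta> \<le> \<mu> * \<eta>" "\<delta> \<le> \<eta>z / 2"
    using assms(2,3,5) by (auto simp: \<delta>_def)
  have "s * (a \<bullet> u) \<le> \<bar>a \<bullet> u\<bar>"
    using assms(6) by (metis abs_ge_self abs_mult mult_1)
  also have "\<dots> \<le> \<eta> / 2 * (norm a)\<^sup>2 + (norm u)\<^sup>2 / (2 * \<eta>)"
    by (rule Young_inner) fact
  finally have "\<Phi> \<le> (norm u)\<^sup>2 / \<eta> + F / \<eta>z + \<eta> / 2 * (norm a)\<^sup>2"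
    by (simp add: \<Phi> field_simps)
  then have "\<delta> * \<Phi> \<le> \<delta> * ((norm u)\<^sup>2 / \<eta> + F / \<eta>z + \<eta> / 2 * (norm a)\<^sup>2)"
    using \<delta>(1) by (rule mult_left_mono)
  also have "\<dots> = \<delta> * ((norm u)\<^sup>2 / \<eta>) + \<delta> * (F / \<eta>z + \<eta> / 2 * (norm a)\<^sup>2)"
    by (simp add: algebra_simps)
  also have "\<dots> \<le> \<mu> * \<eta> * ((norm u)\<^sup>2 / \<eta>) + \<eta>z / 2 * (F / \<eta>z + \<eta> / 2 * (norm a)\<^sup>2)"
    using \<delta> assms(2,3,7) by (intro add_mono mult_right_mono) auto
  also have "\<dots> = \<mu> * (norm u)\<^sup>2 + F / 2 + \<eta> * \<eta>z * (norm a)\<^sup>2 / 4"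
    using assms(2,3) by (simp add: field_simps)
  also have "\<dots> \<le> \<mu> * (norm u)\<^sup>2 + F + (norm a)\<^sup>2 / (2 * L)"
  proof -
    have "\<eta> * \<eta>z \<le> 1 / L"
      using assms(1,4) by (simp add: field_simps)
    then have "\<eta> * \<eta>z * (norm a)\<^sup>2 \<le> 1 / L * (norm a)\<^sup>2"
      by (rule mult_right_mono) simp
    moreover have "0 \<le> (norm a)\<^sup>2 / L"
      using assms(1) by simp
    ultimately show ?thesis using assms(7) by simp
  qed
  finally have "(1 + \<delta>) * \<Phi> \<le> \<Psi>"
    using cocoercive decrease by (simp add: algebra_simps)
  then have "\<Phi> \<le> 1 / (1 + \<delta>) * \<Psi>"
    using \<delta>(1) by (simp add: field_simps)
  moreover have "1 / (1 + \<delta>) = max (1 / (1 + \<mu> * \<eta>)) (2 / (2 + \<eta>z))"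
  proof -
    have "2 / (2 + \<eta>z) = 1 / (1 + \<eta>z / 2)"
      using assms(3) by (simp add: field_simps)
    then show ?thesis
      using frac_le[of 1 1 "1 + \<mu> * \<eta>" "1 + \<eta>z / 2"] frac_le[of 1 1 "1 + \<eta>z / 2" "1 + \<mu> * \<eta>"]
        assms(2,3,5) by (auto simp: \<delta>_def min_def max_def add_pos_nonneg)
  qed
  ultimately show ?thesis by simp
qed

text \<open>Both methods evaluate the coupling at an extrapolated point: APGD extrapolates the primal
  variable (\<open>v = 2 u' - u\<close>, \<open>b = a\<close>), APGE the gradient (\<open>v = u\<close>, \<open>b = 2 a' - a\<close>). Either way the
  cross terms telescope up to \<open>(a' - a) \<bullet> (u' - u)\<close>, which the two quadratic remainders absorb.\<close>

lemma Lyapunov_decrease: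
  fixes u u' a a' w w' b v :: "'a::real_inner"
  assumes "L > 0" "\<eta> > 0" "\<eta>z > 0" "L * \<eta> * \<eta>z \<le> 1"
    and mono: "\<mu> * (norm u')\<^sup>2 \<le> ((1 / \<eta>) *\<^sub>R (u - u') - b) \<bullet> u'"
    and step: "w' - w = \<eta>z *\<^sub>R (v - w')"
    and bregman: "F' + a' \<bullet> (w - w') + (norm (a - a'))\<^sup>2 / (2 * L) \<le> F"
    and s: "s = -1 \<and> v = 2 *\<^sub>R u' - u \<and> b = a \<or> s = 1 \<and> v = u \<and> b = 2 *\<^sub>R a' - a"
  shows "1 / (2 * \<eta>) * (norm u')\<^sup>2 + 1 / \<eta>z * F' + s * (a' \<bullet> u') + \<mu> * (norm u')\<^sup>2 + a' \<bullet> w'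
    \<le> 1 / (2 * \<eta>) * (norm u)\<^sup>2 + 1 / \<eta>z * F + s * (a \<bullet> u)"
proof -
  \<comment> \<open>The three-point identity for \<open>(u - u') \<bullet> u'\<close> turns
    \<open>mono\<close> into a difference of squares.\<close>
  have ineq_x: "\<mu> * (norm u')\<^sup>2 + b \<bullet> u'
      \<le> (norm u)\<^sup>2 / (2 * \<eta>) - (norm u')\<^sup>2 / (2 * \<eta>) - (norm (u' - u))\<^sup>2 / (2 * \<eta>)"
  proof -
    have "u \<bullet> u' - u' \<bullet> u' = ((norm u)\<^sup>2 - (norm u')\<^sup>2 - (norm (u' - u))\<^sup>2) / 2"
      by (simp add: power2_norm_eq_inner inner_diff_left inner_diff_right inner_commute)
    then have "(u \<bullet> u' - u' \<bullet> u') / \<eta>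
        = ((norm u)\<^sup>2 - (norm u')\<^sup>2 - (norm (u' - u))\<^sup>2) / (2 * \<eta>)"
      by (metis divide_divide_eq_left)
    with mono show ?thesis
      by (simp add: inner_diff_left diff_divide_distrib)
  qed
  have "w - w' = - (\<eta>z *\<^sub>R (v - w'))"
    using step by (metis minus_diff_eq)
  with bregman have "F' - \<eta>z * (a' \<bullet> (v - w')) + (norm (a - a'))\<^sup>2 / (2 * L) \<le> F"
    by simp
  then have "(F' - \<eta>z * (a' \<bullet> (v - w')) + (norm (a - a'))\<^sup>2 / (2 * L)) / \<eta>z \<le> F / \<eta>z"
    using assms(3) by (intro divide_right_mono) auto
  then have ineq_z: "F' / \<eta>z + a' \<bullet> w' + (norm (a - a'))\<^sup>2 / (2 * L * \<eta>z) \<le> F / \<eta>z + a' \<bullet> v"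
    using assms(3) by (simp add: add_divide_distrib diff_divide_distrib inner_diff_right)
  \<comment> \<open>The stepsize condition makes the gradient half of Young's bound fit under the
    smoothness remainder of \<open>ineq_z\<close>.\<close>
  have "\<eta> \<le> 1 / (L * \<eta>z)"
    using assms(1,3,4) by (simp add: field_simps)
  then have "\<eta> * (norm (a - a'))\<^sup>2 \<le> 1 / (L * \<eta>z) * (norm (a - a'))\<^sup>2"
    by (rule mult_right_mono) simp
  then have "\<eta> / 2 * (norm (a - a'))\<^sup>2 \<le> (norm (a - a'))\<^sup>2 / (2 * L * \<eta>z)"
    by simp
  with Young_inner[OF assms(2), of "a - a'" "u' - u"]
  have cross: "\<bar>(a - a') \<bullet> (u' - u)\<bar> \<le> (norm (a - a'))\<^sup>2 / (2 * L * \<eta>z) + (norm (u' - u))\<^sup>2 / (2 * \<eta>)"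
    by linarith
  \<comment> \<open>The left side equals \<open>s * ((a - a') \<bullet> (u' - u))\<close> in both
    cases, so \<open>cross\<close> covers either sign.\<close>
  have "s * (a' \<bullet> u') - s * (a \<bullet> u) - b \<bullet> u' + a' \<bullet> v \<le> \<bar>(a - a') \<bullet> (u' - u)\<bar>"
    using s by (auto simp: inner_diff_left inner_diff_right)
  with ineq_x ineq_z cross show ?thesis
    by simp
qed

text \<open>The averaging update is an implicit Euler step,
  \<open>z' - z = \<eta>z *\<^sub>R (y - z')\<close>, from which the reference point
  \<open>c\<close> cancels.\<close>

lemma extrapolation_step:
  fixes z z' y c :: "'a::real_vector"
  assumes "\<eta>z > 0" and "z' = (1 / (1 + \<eta>z)) *\<^sub>R z + (\<eta>z / (1 + \<eta>z)) *\<^sub>R y"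
  shows "(z' - c) - (z - c) = \<eta>z *\<^sub>R ((y - c) - (z' - c))"
proof -
  have "(1 + \<eta>z) *\<^sub>R z' = z + \<eta>z *\<^sub>R y"
    using assms by (simp add: scaleR_add_right)
  then show ?thesis
    by (simp add: algebra_simps)
qed

theorem theorem1:
  fixes f :: "'a::euclidean_space \<Rightarrow> real" and g :: "'a \<Rightarrow> ereal"
    and Lf \<mu>g \<eta>x \<eta>z s :: real and xs zs :: 'a and x z :: "nat \<Rightarrow> 'a"
  assumes "Lf > 0" and "convex_on UNIV f" and "smooth_fun Lf f"
    and "\<mu>g \<ge> 0" and "proper_fun g" and "closed_fun g" and "strongly_convex_fun \<mu>g g"
    and "0 \<in> {p + grad f zs |p. p \<in> subdifferential g xs}" and "zs = xs"
    and "\<eta>x > 0" and "\<eta>z > 0" and "Lf * \<eta>x * \<eta>z \<le> 1"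
    and "(APGD f g \<eta>x \<eta>z x z \<and> s = -1) \<or> (APGE f g \<eta>x \<eta>z x z \<and> s = 1)"
  shows "\<forall>k. Lyapunov f \<eta>x \<eta>z s xs zs (x k) (z k)
           \<le> (max (1 / (1 + \<mu>g * \<eta>x)) (2 / (2 + \<eta>z))) ^ k
               * Lyapunov f \<eta>x \<eta>z s xs zs (x 0) (z 0)"
proof -
  let ?\<theta> = "max (1 / (1 + \<mu>g * \<eta>x)) (2 / (2 + \<eta>z))"
  let ?\<Phi> = "\<lambda>k. Lyapunov f \<eta>x \<eta>z s xs zs (x k) (z k)"
  define a where "a k = grad f (z k) - grad f zs" for k
  \<comment> \<open>\<open>b\<close> and \<open>v\<close> merge both methods into one recursion.
    Each looks one index ahead only at what is already updated: APGE computes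
    \<open>z (Suc k)\<close> first, APGD \<open>x (Suc k)\<close>.\<close>
  define b where "b k = (if s = 1 then 2 *\<^sub>R a (Suc k) - a k else a k)" for k
  define v where "v k = (if s = 1 then x k else 2 *\<^sub>R x (Suc k) - x k)" for k
  \<comment> \<open>This subgradient serves twice: it guarantees that the proximal minimizers exist,
    and it is the comparison point for strong monotonicity, where \<open>grad f zs\<close>
    cancels.\<close>
  have sub: "- grad f zs \<in> subdifferential g xs"
    using assms(8) by (auto simp: eq_neg_iff_add_eq_0[symmetric])
  have conv: "convex_fun g"
    using assms(7) by (simp add: strongly_convex_fun_def)
  have xstep: "x (Suc k) = prox (\<lambda>w. ereal \<eta>x * g w) (x k - \<eta>x *\<^sub>R (b k + grad f zs))"
    and zstep: "z (Suc k) = (1 / (1 + \<eta>z)) *\<^sub>R z k + (\<eta>z / (1 + \<eta>z)) *\<^sub>R v k" for k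
    using assms(13) by (auto simp: APGD_def APGE_def a_def b_def v_def scaleR_2 algebra_simps)
  have contract: "?\<Phi> (Suc k) \<le> ?\<theta> * ?\<Phi> k" for k
  proof -
    have "(1 / \<eta>x) *\<^sub>R (x k - \<eta>x *\<^sub>R (b k + grad f zs) - x (Suc k)) \<in> subdifferential g (x (Suc k))"
      unfolding xstep[of k] by (rule prox_subgradient[OF assms(5,6) conv sub assms(10)])
    from subdifferential_strongly_monotone[OF assms(5,7) this sub]
    have mono: "\<mu>g * (norm (x (Suc k) - xs))\<^sup>2
        \<le> ((1 / \<eta>x) *\<^sub>R ((x k - xs) - (x (Suc k) - xs)) - b k) \<bullet> (x (Suc k) - xs)"
      using assms(10) by (simp add: scaleR_diff_right algebra_simps)
    have breg: "bregman f (z (Suc k)) zs + a (Suc k) \<bullet> ((z k - xs) - (z (Suc k) - xs))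
        + (norm (a k - a (Suc k)))\<^sup>2 / (2 * Lf) \<le> bregman f (z k) zs"
      using bregman_lower_bound[OF assms(1-3), of "z (Suc k)" zs "z k"] by (simp add: a_def)
    \<comment> \<open>Here \<open>zs\<close> is both base point and evaluation point;
      \<open>zs = xs\<close> lets the offset of \<open>z\<close> be measured from \<open>xs\<close>,
      as in the primal terms.\<close>
    have coco: "bregman f (z (Suc k)) zs + (norm (a (Suc k)))\<^sup>2 / (2 * Lf)
        \<le> a (Suc k) \<bullet> (z (Suc k) - xs)"
      using bregman_lower_bound[OF assms(1-3), of "z (Suc k)" zs zs] assms(9)
      by (simp add: a_def norm_minus_commute inner_diff_right)
    have cases_s: "s = -1 \<and> v k - xs = 2 *\<^sub>R (x (Suc k) - xs) - (x k - xs) \<and> b k = a k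
        \<or> s = 1 \<and> v k - xs = x k - xs \<and> b k = 2 *\<^sub>R a (Suc k) - a k"
      using assms(13) by (auto simp: b_def v_def algebra_simps scaleR_2)
    have "?\<Phi> (Suc k) + \<mu>g * (norm (x (Suc k) - xs))\<^sup>2 + a (Suc k) \<bullet> (z (Suc k) - xs) \<le> ?\<Phi> k"
      unfolding Lyapunov_def a_def[symmetric]
      by (rule Lyapunov_decrease[OF assms(1,10,11,12) mono
            extrapolation_step[OF assms(11) zstep] breg cases_s])
    moreover have "\<bar>s\<bar> = 1"
      using assms(13) by auto
    ultimately show ?thesis
      by (intro Lyapunov_contraction[where s = s, OF assms(1,10,11,12,4) _ bregman_nonneg[OF assms(2,3)] coco])
        (simp_all add: Lyapunov_def a_def)
  qed
  have "0 \<le> ?\<theta>"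
    using assms(11) by (simp add: le_max_iff_disj)
  have "?\<Phi> k \<le> ?\<theta> ^ k * ?\<Phi> 0" for k
  proof (induction k)
    case (Suc k)
    have "?\<Phi> (Suc k) \<le> ?\<theta> * (?\<theta> ^ k * ?\<Phi> 0)"
      using contract[of k] mult_left_mono[OF Suc \<open>0 \<le> ?\<theta>\<close>] by linarith
    then show ?case by (simp add: mult_ac)
  qed simp
  then show ?thesis by blast
qed

end
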